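(* Let $\ell>2$ be an odd prime and let $a,b,N\in\mathbb F_\ell^*$ with $a\neq b$. Set $A=4aN$, $B=4bN$ (elements of $\mathbb F_\ell^*$), $r_A=1+\chi(A)\in\{0,2\}$, $r_B=1+\chi(B)\in\{0,2\}$, and $U_{a,b}=H_a(N;\ell)\cup H_b(N;\ell)$. Then $$4\,|\mathbb F_\ell\setminus U_{a,b}| = \ell+2-r_A-r_B+K(A,B)+r_B\,\chi(B-A)+r_A\,\chi(A-B),$$ where $K(A,B)=\sum_{z\in\mathbb F_\ell}\chi\bigl((z^2-A)(z^2-B)\bigr)$.
   Context: $\chi$ denotes the Legendre symbol modulo the odd prime $\ell$, viewed as a function on $\mathbb F_\ell$ with $\chi(0)=0$. For $a,N\in\mathbb F_\ell^*$, $H_a(N;\ell)=\{ax+Nx^{-1}: x\in\mathbb F_\ell^*\}\subseteq\mathbb F_\ell$. *)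

theory Defs
  imports
    "Berlekamp_Zassenhaus.Finite_Field"
    "HOL-Number_Theory.Residues"
begin

(* The prime field of order l is the type 'p mod_ring with 'p :: prime_card and l = CARD('p).
   Legendre a l depends only on the class of a modulo l, so evaluating it at the canonical
   representative in {0..<l} loses nothing; Legendre gives chi 0 = 0. *)
definition chi :: "'p::prime_card mod_ring \<Rightarrow> int" where
  "chi x = Legendre (to_int_mod_ring x) (int CARD('p))"

definition H :: "'p::prime_card mod_ring \<Rightarrow> 'p mod_ring \<Rightarrow> 'p mod_ring set" where
  "H a N = {a * x + N * inverse x | x. x \<noteq> 0}"

definition K :: "'p::prime_card mod_ring \<Rightarrow> 'p mod_ring \<Rightarrow> int" where
  "K A B = (\<Sum>z\<in>UNIV. chi ((z^2 - A) * (z^2 - B)))"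

end

theory Submission
  imports Defs "HOL-Number_Theory.Euler_Criterion"
begin

text \<open>
  For \<open>a, N \<noteq> 0\<close> the equation \<open>a x + N / x = z\<close> is the quadratic equation
  \<open>a x\<^sup>2 - z x + N = 0\<close>, whose roots are automatically nonzero and whose discriminant is
  \<open>z\<^sup>2 - A\<close> with \<open>A = 4 a N\<close>.  Hence each \<open>z\<close> has exactly \<open>1 + \<chi>(z\<^sup>2 - A)\<close> preimages
  (\<open>card_H_fibre\<close>).  This has two consequences: \<open>z\<close> lies outside \<open>H a N\<close> exactly when
  \<open>\<chi>(z\<^sup>2 - A) = -1\<close>, and, since the \<open>\<ell> - 1\<close> nonzero values of \<open>x\<close> are distributed over the
  fibres, \<open>\<Sum>\<^sub>z \<chi>(z\<^sup>2 - A) = -1\<close> (\<open>sum_chi_square_minus\<close>).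

  Therefore \<open>(1 - \<chi>(z\<^sup>2 - A)) (1 - \<chi>(z\<^sup>2 - B))\<close> is \<open>4\<close> when \<open>z\<close> avoids both sets, and \<open>0\<close> when
  \<open>z\<close> lies in one of them, except where one of the two characters vanishes: at the
  \<open>1 + \<chi>(A)\<close> square roots of \<open>A\<close> the product is \<open>1 - \<chi>(A - B)\<close>, and at the \<open>1 + \<chi>(B)\<close>
  square roots of \<open>B\<close> it is \<open>1 - \<chi>(B - A)\<close>.  The two exceptional cases exclude each other as
  \<open>A \<noteq> B\<close>.  Summing this product over \<open>z\<close>, and evaluating the same sum by expanding the product
  with the multiplicativity of \<open>\<chi>\<close>, gives the formula.
\<close>

lemma two_neq_zero_mod_ring:
  assumes "CARD('p::prime_card) > 2"
  shows "(2::'p mod_ring) \<noteq> 0"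
proof
  assume "(2::'p mod_ring) = 0"
  then have "(of_nat 2 :: 'p mod_ring) = 0" by simp
  then have "CARD('p) dvd 2" by (rule of_nat_0_mod_ring_dvd)
  then show False using assms by (auto dest: dvd_imp_le)
qed

lemma four_neq_zero_mod_ring:
  assumes "CARD('p::prime_card) > 2"
  shows "(4::'p mod_ring) \<noteq> 0"
  using two_neq_zero_mod_ring [OF assms] by (metis mult_eq_0_iff mult_2 numeral_Bit0)

lemma of_int_eq_mod_ring_iff:
  "(of_int m :: 'p::prime_card mod_ring) = of_int n \<longleftrightarrow> [m = n] (mod int CARD('p))"
  by (simp add: of_int_eq_iff_cong_CHAR)

lemma of_int_to_int_mod_ring:
  "of_int (to_int_mod_ring x) = (x :: 'p::prime_card mod_ring)"
  by (simp add: of_int_of_int_mod_ring)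

lemma chi_eq:
  fixes x :: "'p::prime_card mod_ring"
  shows "chi x = (if x = 0 then 0 else if \<exists>y. y^2 = x then 1 else -1)"
proof -
  have zero: "[to_int_mod_ring x = 0] (mod int CARD('p)) \<longleftrightarrow> x = 0"
    by (simp add: of_int_eq_mod_ring_iff [where 'p = 'p, symmetric] of_int_to_int_mod_ring)
  have "QuadRes (int CARD('p)) (to_int_mod_ring x) \<longleftrightarrow> (\<exists>m. (of_int m :: 'p mod_ring)^2 = x)"
    by (simp add: QuadRes_def of_int_eq_mod_ring_iff [where 'p = 'p, symmetric]
        of_int_to_int_mod_ring)
  also have "\<dots> \<longleftrightarrow> (\<exists>y. y^2 = x)"
    by (metis of_int_to_int_mod_ring)
  finally show ?thesis
    using zero by (simp add: chi_def Legendre_def)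
qed

lemma chi_zero [simp]: "chi 0 = 0"
  by (simp add: chi_eq)

lemma chi_cases: "chi x = 0 \<or> chi x = 1 \<or> chi x = -1"
  by (simp add: chi_eq)

lemma of_int_chi:
  fixes x :: "'p::prime_card mod_ring"
  assumes "CARD('p) > 2"
  shows "of_int (chi x) = x ^ ((CARD('p) - 1) div 2)"
proof -
  have "[chi x = to_int_mod_ring x ^ ((CARD('p) - 1) div 2)] (mod int CARD('p))"
    unfolding chi_def by (rule euler_criterion [OF prime_card assms])
  then show ?thesis
    by (simp add: of_int_eq_mod_ring_iff [where 'p = 'p, symmetric] of_int_to_int_mod_ring)
qed

text \<open>
  Both sides lie in \<open>{-1, 0, 1}\<close>, and these integers stay distinct modulo \<open>\<ell> > 2\<close>, so it is enough
  to compare residues; there Euler's criterion turns \<open>\<chi>\<close> into a power map.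
\<close>

lemma chi_mult:
  fixes x y :: "'p::prime_card mod_ring"
  assumes "CARD('p) > 2"
  shows "chi (x * y) = chi x * chi y"
proof -
  have "(of_int (chi (x * y)) :: 'p mod_ring) = of_int (chi x * chi y)"
    by (simp add: of_int_chi [OF assms] power_mult_distrib)
  then have "int CARD('p) dvd chi (x * y) - chi x * chi y"
    by (simp only: of_int_eq_mod_ring_iff cong_iff_dvd_diff)
  moreover have "\<bar>chi (x * y) - chi x * chi y\<bar> < int CARD('p)"
    using chi_cases [of "x * y"] chi_cases [of x] chi_cases [of y] assms by auto
  ultimately show ?thesis
    using zdvd_not_zless [of "\<bar>chi (x * y) - chi x * chi y\<bar>" "int CARD('p)"] by force
qed

lemma card_square_roots:
  fixes c :: "'p::prime_card mod_ring"
  assumes "CARD('p) > 2"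
  shows "int (card {y. y^2 = c}) = 1 + chi c"
proof (cases "\<exists>y. y^2 = c")
  case True
  then obtain w where w: "w^2 = c" by blast
  then have roots: "{y. y^2 = c} = {w, - w}"
    by (auto simp: power2_eq_iff)
  show ?thesis
  proof (cases "c = 0")
    case True
    with w roots show ?thesis by simp
  next
    case False
    with w have "w \<noteq> 0" by auto
    then have "2 * w \<noteq> 0" using two_neq_zero_mod_ring [OF assms] by simp
    then have "w \<noteq> - w" by (metis add.right_inverse mult_2)
    then show ?thesis using roots w False by (auto simp: chi_eq)
  qed
next
  case False
  then have "{y. y^2 = c} = {}" and "c \<noteq> 0" by (auto intro: exI [of _ 0])
  with False show ?thesis by (simp add: chi_eq)
qed

text \<open>
  Completing the square: \<open>x\<close> solves \<open>a x\<^sup>2 - z x + N = 0\<close> exactly when \<open>2 a x - z\<close> is a square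
  root of the discriminant.
\<close>

lemma card_H_fibre:
  fixes a N z :: "'p::prime_card mod_ring"
  assumes l: "CARD('p) > 2" and a: "a \<noteq> 0" and N: "N \<noteq> 0"
  shows "int (card {x. x \<noteq> 0 \<and> a * x + N * inverse x = z}) = 1 + chi (z^2 - 4 * a * N)"
proof -
  have two: "(2::'p mod_ring) \<noteq> 0" by (rule two_neq_zero_mod_ring [OF l])
  have four: "(4::'p mod_ring) \<noteq> 0" by (rule four_neq_zero_mod_ring [OF l])
  have quadratic: "x \<noteq> 0 \<and> a * x + N * inverse x = z \<longleftrightarrow> (2 * a * x - z)^2 = z^2 - 4 * a * N" for x
  proof -
    have "x \<noteq> 0 \<and> a * x + N * inverse x = z \<longleftrightarrow> a * x^2 - z * x + N = 0"
      using N by (cases "x = 0") (auto simp: field_simps power2_eq_square)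
    also have "\<dots> \<longleftrightarrow> 4 * a * (a * x^2 - z * x + N) = 0"
      using four a by simp
    also have "\<dots> \<longleftrightarrow> (2 * a * x - z)^2 = z^2 - 4 * a * N"
      by (simp add: algebra_simps power2_eq_square)
    finally show ?thesis .
  qed
  have "bij_betw (\<lambda>x. 2 * a * x - z)
      {x. x \<noteq> 0 \<and> a * x + N * inverse x = z} {y. y^2 = z^2 - 4 * a * N}"
    using two a unfolding quadratic
    by (intro bij_betwI [where g = "\<lambda>y. (y + z) / (2 * a)"]) auto
  then show ?thesis
    using card_square_roots [OF l, of "z^2 - 4 * a * N"] by (simp add: bij_betw_same_card)
qed

lemma notin_H_iff:
  fixes a N z :: "'p::prime_card mod_ring"
  assumes "CARD('p) > 2" and "a \<noteq> 0" and "N \<noteq> 0"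
  shows "z \<notin> H a N \<longleftrightarrow> chi (z^2 - 4 * a * N) = -1"
proof -
  have "z \<notin> H a N \<longleftrightarrow> card {x. x \<noteq> 0 \<and> a * x + N * inverse x = z} = 0"
    by (auto simp: H_def)
  then show ?thesis
    using card_H_fibre [OF assms, of z] by linarith
qed

text \<open>
  Every nonzero \<open>x\<close> lies in exactly one fibre of \<open>x \<mapsto> a x + N / x\<close>, so the fibre sizes
  \<open>1 + \<chi>(z\<^sup>2 - 4 a N)\<close> add up to \<open>\<ell> - 1\<close>.
\<close>

lemma sum_chi_square_minus:
  fixes a N :: "'p::prime_card mod_ring"
  assumes "CARD('p) > 2" and "a \<noteq> 0" and "N \<noteq> 0"
  shows "(\<Sum>z\<in>UNIV. chi (z^2 - 4 * a * N)) = -1"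
proof -
  let ?F = "\<lambda>z. {x. x \<noteq> 0 \<and> a * x + N * inverse x = z}"
  have "card (- {0 :: 'p mod_ring}) = card (\<Union>z\<in>UNIV. ?F z)"
    by (intro arg_cong [where f = card]) auto
  also have "\<dots> = (\<Sum>z\<in>UNIV. card (?F z))"
    by (intro card_UN_disjoint) auto
  finally have "int (card (- {0 :: 'p mod_ring})) = (\<Sum>z\<in>UNIV. int (card (?F z)))"
    by simp
  also have "\<dots> = int CARD('p) + (\<Sum>z\<in>UNIV. chi (z^2 - 4 * a * N))"
    by (simp add: card_H_fibre [OF assms] sum.distrib)
  finally show ?thesis
    using assms(1) by (simp add: Compl_eq_Diff_UNIV card_Diff_singleton of_nat_diff)
qed

theorem theorem5p1:
  fixes l :: nat
    and a b N A B :: "'p::prime_card mod_ring"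
    and r\<^sub>A r\<^sub>B :: int
    and U :: "'p mod_ring set"
  assumes "l = CARD('p)" and "l > 2"
    and "a \<noteq> 0" and "b \<noteq> 0" and "N \<noteq> 0" and "a \<noteq> b"
    and "A = 4 * a * N" and "B = 4 * b * N"
    and "r\<^sub>A = 1 + chi A" and "r\<^sub>B = 1 + chi B"
    and "U = H a N \<union> H b N"
  shows "A \<noteq> 0 \<and> B \<noteq> 0 \<and> r\<^sub>A \<in> {0, 2} \<and> r\<^sub>B \<in> {0, 2} \<and>
    4 * int (card (UNIV - U)) =
      int l + 2 - r\<^sub>A - r\<^sub>B + K A B + r\<^sub>B * chi (B - A) + r\<^sub>A * chi (A - B)"
proof -
  have l: "CARD('p) > 2" using assms(1,2) by simp
  have four: "(4::'p mod_ring) \<noteq> 0" by (rule four_neq_zero_mod_ring [OF l])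
  have A0: "A \<noteq> 0" and B0: "B \<noteq> 0" and AB: "A \<noteq> B"
    using four assms(3-8) by auto
  have r: "r\<^sub>A \<in> {0, 2}" "r\<^sub>B \<in> {0, 2}"
    using A0 B0 assms(9,10) by (auto simp: chi_eq)

  \<comment> \<open>If both characters are nonzero, each factor is \<open>0\<close> or \<open>2\<close>, whence the weight \<open>4\<close>; a vanishing
    character makes its factor \<open>1\<close> and leaves the other one, which the last two terms record.\<close>
  let ?P = "\<lambda>z. (1 - chi (z^2 - A)) * (1 - chi (z^2 - B))"
  have pointwise: "?P z = 4 * of_bool (z \<in> UNIV - U)
      + of_bool (z^2 = A) * (1 - chi (A - B)) + of_bool (z^2 = B) * (1 - chi (B - A))" for z
  proof -
    have U: "z \<in> UNIV - U \<longleftrightarrow> chi (z^2 - A) = -1 \<and> chi (z^2 - B) = -1"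
      using notin_H_iff [OF l \<open>a \<noteq> 0\<close> \<open>N \<noteq> 0\<close>] notin_H_iff [OF l \<open>b \<noteq> 0\<close> \<open>N \<noteq> 0\<close>]
      by (simp add: assms(7,8,11))
    have zero: "chi (z^2 - A) = 0 \<longleftrightarrow> z^2 = A" "chi (z^2 - B) = 0 \<longleftrightarrow> z^2 = B"
      by (simp_all add: chi_eq)
    consider "z^2 = A" | "z^2 = B" | "z^2 \<noteq> A" "z^2 \<noteq> B" by blast
    then show ?thesis
    proof cases
      case 3
      then show ?thesis
        using U zero chi_cases [of "z^2 - A"] chi_cases [of "z^2 - B"] by auto
    qed (use AB U in auto)
  qed

  have roots: "(\<Sum>z\<in>UNIV. of_bool (z^2 = c) * d) = (1 + chi c) * d"
    for c :: "'p mod_ring" and d :: int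
    by (simp add: sum_distrib_right [symmetric] card_square_roots [OF l, symmetric]
        sum_of_bool_eq)
  have "(\<Sum>z\<in>UNIV. ?P z) = 4 * int (card (UNIV - U))
      + r\<^sub>A * (1 - chi (A - B)) + r\<^sub>B * (1 - chi (B - A))"
    unfolding pointwise sum.distrib roots assms(9,10)
    by (simp add: sum_distrib_left [symmetric] sum_of_bool_eq set_diff_eq)
  moreover have "(\<Sum>z\<in>UNIV. ?P z) = int l + 2 + K A B"
  proof -
    have "(\<Sum>z\<in>UNIV. ?P z)
        = (\<Sum>z\<in>UNIV. 1 - chi (z^2 - A) - chi (z^2 - B) + chi ((z^2 - A) * (z^2 - B)))"
      unfolding chi_mult [OF l] by (simp add: algebra_simps)
    also have "\<dots> = int l - (\<Sum>z\<in>UNIV. chi (z^2 - A)) - (\<Sum>z\<in>UNIV. chi (z^2 - B)) + K A B"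
      by (simp add: sum.distrib sum_subtractf K_def assms(1))
    also have "\<dots> = int l + 2 + K A B"
      using sum_chi_square_minus [OF l \<open>a \<noteq> 0\<close> \<open>N \<noteq> 0\<close>] sum_chi_square_minus [OF l \<open>b \<noteq> 0\<close> \<open>N \<noteq> 0\<close>]
      by (simp add: assms(7,8))
    finally show ?thesis .
  qed
  ultimately show ?thesis
    using A0 B0 r by (simp add: algebra_simps)
qed

end
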